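(* Let $m\ge 3$ be an integer and let $\mathcal P_m\subset\mathbb R^3$ be the convex hull of the eight points $$(0,0,0),\ (0,0,1),\ (1,0,0),\ (1,0,1),\ (0,1,0),\ (0,1,1),\ (1,1,m),\ (1,1,m+1).$$ The gap vector of $\mathcal P_m$ has the entries $$\operatorname{gv}_k(\mathcal P_m)=\binom{k+1}{3}(m-k-1).$$ In particular, $\gamma(\mathcal P_m)=m-2$ and $$\operatorname{gv}_1(\mathcal P_m)\le\cdots\le\operatorname{gv}_j(\mathcal P_m)\ge\operatorname{gv}_{j+1}(\mathcal P_m)\ge\cdots\ge\operatorname{gv}_{m-2}(\mathcal P_m)$$ for $j=\left\lceil\frac{3m-5}{4}\right\rceil$.
   Context: For a lattice polytope $\mathcal P\subset\mathbb R^d$ (all vertices in $\mathbb Z^d$), let $M_{\mathcal P}\subset\mathbb Z^{d+1}$ be the additive submonoid generated by the points $(\mathbf x,1)$ with $\mathbf x\in\mathcal P\cap\mathbb Z^d$. Let $\operatorname{gp}(M_{\mathcal P})$ be the subgroup of $\mathbb Z^{d+1}$ generated by $M_{\mathcal P}$, and let $\overline{M_{\mathcal P}}=\operatorname{gp}(M_{\mathcal P})\cap\mathbb R_{\ge0}M_{\mathcal P}$ be the normalization, where $\mathbb R_{\ge0}M_{\mathcal P}$ is the conical hull. The height (degree) of an element is its last coordinate. The polytope $\mathcal P$ is very ample if $\overline{M_{\mathcal P}}\setminus M_{\mathcal P}$ is finite and the group $\sum_{\mathbf x,\mathbf y\in\mathcal P\cap\mathbb Z^d}\mathbb Z(\mathbf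 x-\mathbf y)$ is a direct summand of $\mathbb Z^d$; the polytopes $\mathcal P_m$ are very ample. For $\mathcal P$ very ample: - a gap in $M_{\mathcal P}$ is an element of $\overline{M_{\mathcal P}}\setminus M_{\mathcal P}$; - $\gamma(\mathcal P)$ is the largest height at which there is a gap, with $\gamma(\mathcal P)=0$ if there are no gaps; - the gap vector $\operatorname{gv}(\mathcal P)$ has the entries $\operatorname{gv}_k(\mathcal P)$, the number of gaps in $M_{\mathcal P}$ at height $k$, stopping at the largest height $\gamma(\mathcal P)$ that contains gaps.
   Formalization: The claim γ(P_m)=m−2 is false for m=3: P_3 has no gaps (gv_1=0), so γ(P_3)=0 by convention; the formal statement gives γ(P_m)=m−2 for m≥4 and γ(P_3)=0, all else for m≥3. *)

theory Defs
  imports "HOL-Analysis.Analysis" "HOL-Computational_Algebra.Group_Closure"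
begin

definition integer_lattice :: "(real ^ 'd) set" where
  "integer_lattice = {x. \<forall>i. x $ i \<in> \<int>}"

definition lattice_polytope :: "(real ^ 'd) set \<Rightarrow> bool" where
  "lattice_polytope P \<longleftrightarrow> polytope P \<and> {v. v extreme_point_of P} \<subseteq> integer_lattice"

inductive_set monoid_closure :: "'a::comm_monoid_add set \<Rightarrow> 'a set" for S where
  zero: "0 \<in> monoid_closure S"
| base: "s \<in> S \<Longrightarrow> s \<in> monoid_closure S"
| add: "s \<in> monoid_closure S \<Longrightarrow> t \<in> monoid_closure S \<Longrightarrow> s + t \<in> monoid_closure S"

text \<open>
  The space of dimension d + 1 is rendered as the product of \<^typ>\<open>real ^ 'd\<close> with
  \<^typ>\<open>real\<close>; the height of an element is its second component.
\<close>

definition polytope_monoid :: "(real ^ 'd) set \<Rightarrow> ((real ^ 'd) \<times> real) set" where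
  "polytope_monoid P = monoid_closure ((\<lambda>x. (x, 1)) ` (P \<inter> integer_lattice))"

definition normalization :: "((real ^ 'd) \<times> real) set \<Rightarrow> ((real ^ 'd) \<times> real) set" where
  "normalization M = group_closure M \<inter> (convex_cone hull M)"

definition gaps :: "(real ^ 'd) set \<Rightarrow> ((real ^ 'd) \<times> real) set" where
  "gaps P = normalization (polytope_monoid P) - polytope_monoid P"

text \<open>Internal direct summand, for subgroups of an additive group.\<close>

definition direct_summand :: "'a::ab_group_add set \<Rightarrow> 'a set \<Rightarrow> bool" where
  "direct_summand D G \<longleftrightarrow>
     group_closure D = D \<and>
     (\<exists>K. group_closure K = K \<and> D \<inter> K = {0} \<and> {a + b | a b. a \<in> D \<and> b \<in> K} = G)"

definition very_ample :: "(real ^ 'd) set \<Rightarrow> bool" where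
  "very_ample P \<longleftrightarrow>
     lattice_polytope P \<and>
     finite (gaps P) \<and>
     direct_summand
       (group_closure {x - y | x y. x \<in> P \<inter> integer_lattice \<and> y \<in> P \<inter> integer_lattice})
       integer_lattice"

definition gap_vector_entry :: "(real ^ 'd) set \<Rightarrow> nat \<Rightarrow> nat" where
  "gap_vector_entry P k = card {g \<in> gaps P. snd g = real k}"

text \<open>
  Elements of the normalization have nonnegative integer height, so heights can be taken
  in \<^typ>\<open>nat\<close>. The value is meaningful only if there are finitely many gaps.
\<close>

definition max_gap_height :: "(real ^ 'd) set \<Rightarrow> nat" where
  "max_gap_height P =
     (if gaps P = {} then 0 else Max {k. \<exists>g \<in> gaps P. snd g = real k})"

definition polytope_P :: "nat \<Rightarrow> (real ^ 3) set" where
  "polytope_P m = convex hull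
     {vector [0, 0, 0], vector [0, 0, 1],
      vector [1, 0, 0], vector [1, 0, 1],
      vector [0, 1, 0], vector [0, 1, 1],
      vector [1, 1, real m], vector [1, 1, real m + 1]}"

end

theory Submission
  imports Defs
begin

text \<open>
  The monoid consists of the \<open>(x, y, z, k)\<close> for which \<open>z\<close> lies in one of the strips
  \<open>[m a, m a + k]\<close>, where \<open>max 0 (x + y - k) \<le> a \<le> min x y\<close>; the normalization fills in the
  space between consecutive strips. So a gap at height \<open>k\<close> is given by two consecutive values
  \<open>a\<close>, \<open>a + 1\<close> and one of the \<open>m - k - 1\<close> integers strictly between the two strips, and the
  triples \<open>(x, y, a)\<close> correspond to the weak compositions of \<open>k - 2\<close> into four parts.
\<close>

section \<open>Integer coordinates on R^3 and on R^3 x R\<close>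

definition lattice_point :: "int \<Rightarrow> int \<Rightarrow> int \<Rightarrow> real ^ 3" where
  "lattice_point x y z = vector [of_int x, of_int y, of_int z]"

definition graded_point :: "int \<Rightarrow> int \<Rightarrow> int \<Rightarrow> int \<Rightarrow> (real ^ 3) \<times> real" where
  "graded_point x y z k = (lattice_point x y z, of_int k)"

lemma lattice_point_nth [simp]:
  "lattice_point x y z $ 1 = of_int x"
  "lattice_point x y z $ 2 = of_int y"
  "lattice_point x y z $ 3 = of_int z"
  by (simp_all add: lattice_point_def)

lemma lattice_point_eq_iff [simp]:
  "lattice_point x y z = lattice_point x' y' z' \<longleftrightarrow> x = x' \<and> y = y' \<and> z = z'"
  by (auto simp: vec_eq_iff forall_3)

lemma lattice_point_eq_0_iff: "lattice_point x y z = 0 \<longleftrightarrow> x = 0 \<and> y = 0 \<and> z = 0"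
  by (auto simp: vec_eq_iff forall_3)

lemma lattice_point_diff:
  "lattice_point x y z - lattice_point x' y' z' = lattice_point (x - x') (y - y') (z - z')"
  by (auto simp: vec_eq_iff forall_3)

lemma lattice_point_add:
  "lattice_point x y z + lattice_point x' y' z' = lattice_point (x + x') (y + y') (z + z')"
  by (auto simp: vec_eq_iff forall_3)

lemma graded_point_eq_iff [simp]:
  "graded_point x y z k = graded_point x' y' z' k' \<longleftrightarrow> x = x' \<and> y = y' \<and> z = z' \<and> k = k'"
  by (auto simp: graded_point_def)

lemma graded_point_0: "graded_point 0 0 0 0 = 0"
  by (simp add: graded_point_def zero_prod_def lattice_point_eq_0_iff)

lemma graded_point_diff:
  "graded_point x y z k - graded_point x' y' z' k' = graded_point (x - x') (y - y') (z - z') (k - k')"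
  by (simp add: graded_point_def lattice_point_diff)

lemma graded_point_add:
  "graded_point x y z k + graded_point x' y' z' k' = graded_point (x + x') (y + y') (z + z') (k + k')"
  by (simp add: graded_point_def lattice_point_add)

lemma snd_graded_point [simp]: "snd (graded_point x y z k) = of_int k"
  by (simp add: graded_point_def)

lemma integer_lattice_3: "integer_lattice = {lattice_point x y z | x y z. True}"
proof (intro set_eqI iffI)
  fix v :: "real ^ 3"
  assume "v \<in> integer_lattice"
  then have "v $ 1 \<in> \<int>" "v $ 2 \<in> \<int>" "v $ 3 \<in> \<int>"
    by (auto simp: integer_lattice_def)
  then obtain x y z where "v $ 1 = of_int x" "v $ 2 = of_int y" "v $ 3 = of_int z"
    by (auto elim!: Ints_cases)
  then have "v = lattice_point x y z"
    by (simp add: vec_eq_iff forall_3)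
  then show "v \<in> {lattice_point x y z | x y z. True}"
    by blast
qed (auto simp: integer_lattice_def forall_3)

text \<open>Serves to reach every lattice point from unit vectors that lie in a
  \<open>group_closure\<close>.\<close>

lemma group_closure_of_int_scaleR:
  fixes g :: "'a::real_vector"
  assumes "g \<in> group_closure S"
  shows "of_int n *\<^sub>R g \<in> group_closure S"
proof -
  have *: "of_nat j *\<^sub>R g \<in> group_closure S" for j
    by (induction j) (auto simp: scaleR_left_distrib intro: group_closure_add assms)
  show ?thesis
  proof (cases n rule: int_cases2)
    case (nonneg j)
    then show ?thesis using *[of j] by simp
  next
    case (nonpos j)
    then show ?thesis using *[of j] by simp
  qed
qed

section \<open>The cone over the polytope\<close>

text \<open>At \<open>k = 1\<close> the conditions on the third coordinate place it between max(0,
  m(x + y - 1)) and min(mx, my) + 1, the lower and upper boundary of the polytope over the unit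
  square; general \<open>k\<close> homogenizes them. The set serves as an outer bound for the
  normalization.\<close>

definition polytope_cone :: "real \<Rightarrow> ((real ^ 3) \<times> real) set" where
  "polytope_cone m = {(v, k).
     0 \<le> v $ 1 \<and> v $ 1 \<le> k \<and> 0 \<le> v $ 2 \<and> v $ 2 \<le> k \<and>
     0 \<le> v $ 3 \<and> m * (v $ 1 + v $ 2 - k) \<le> v $ 3 \<and>
     v $ 3 \<le> m * v $ 1 + k \<and> v $ 3 \<le> m * v $ 2 + k}"

lemma convex_cone_polytope_cone: "convex_cone (polytope_cone m)"
  unfolding convex_cone_iff
proof (intro conjI ballI allI impI)
  show "0 \<in> polytope_cone m"
    by (simp add: polytope_cone_def zero_prod_def)
next
  fix g h assume "g \<in> polytope_cone m" "h \<in> polytope_cone m"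
  moreover obtain v k w l where "g = (v, k)" "h = (w, l)"
    by (cases g, cases h)
  ultimately show "g + h \<in> polytope_cone m"
    unfolding polytope_cone_def by (simp add: distrib_left right_diff_distrib)
next
  fix g :: "(real ^ 3) \<times> real" and c :: real
  assume g: "g \<in> polytope_cone m" and c: "0 \<le> c"
  obtain v k where vk: "g = (v, k)" by (cases g)
  have "c * (m * (v $ 1 + v $ 2 - k)) \<le> c * v $ 3"
    "c * v $ 3 \<le> c * (m * v $ 1 + k)" "c * v $ 3 \<le> c * (m * v $ 2 + k)"
    using g by (auto simp: vk polytope_cone_def intro!: mult_left_mono c)
  moreover have "c * v $ 1 \<le> c * k" "c * v $ 2 \<le> c * k"
    "0 \<le> c * v $ 1" "0 \<le> c * v $ 2" "0 \<le> c * v $ 3"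
    using g c by (simp_all add: vk polytope_cone_def mult_left_mono)
  ultimately show "c *\<^sub>R g \<in> polytope_cone m"
    by (simp add: vk polytope_cone_def distrib_left right_diff_distrib mult.left_commute)
qed

definition polytope_vertices :: "nat \<Rightarrow> (real ^ 3) set" where
  "polytope_vertices m = {lattice_point 0 0 0, lattice_point 0 0 1,
     lattice_point 1 0 0, lattice_point 1 0 1, lattice_point 0 1 0, lattice_point 0 1 1,
     lattice_point 1 1 (int m), lattice_point 1 1 (int m + 1)}"

lemma polytope_P_eq: "polytope_P m = convex hull (polytope_vertices m)"
  by (simp add: polytope_P_def polytope_vertices_def lattice_point_def)

text \<open>The slice of a convex cone at height 1 is convex, so checking the eight vertices is
  enough.\<close>

lemma polytope_P_subset_cone:
  assumes "v \<in> polytope_P m"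
  shows "(v, 1) \<in> polytope_cone (real m)"
proof -
  have "convex {v. (v, 1) \<in> polytope_cone (real m)}"
    unfolding convex_def
  proof (intro ballI allI impI, simp)
    fix x y :: "real ^ 3" and a b :: real
    assume *: "(x, 1) \<in> polytope_cone (real m)" "(y, 1) \<in> polytope_cone (real m)"
      "0 \<le> a" "0 \<le> b" "a + b = 1"
    have "a *\<^sub>R (x, 1) + b *\<^sub>R (y, 1) \<in> polytope_cone (real m)"
      by (intro convex_cone_add convex_cone_scaleR convex_cone_polytope_cone *)
    with * show "(a *\<^sub>R x + b *\<^sub>R y, 1) \<in> polytope_cone (real m)"
      by simp
  qed
  moreover have "polytope_vertices m \<subseteq> {v. (v, 1) \<in> polytope_cone (real m)}"
    by (auto simp: polytope_vertices_def polytope_cone_def)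
  ultimately show ?thesis
    using assms hull_minimal[of "polytope_vertices m" _ convex] unfolding polytope_P_eq by blast
qed

text \<open>Lattice points can lie only over the four corners of the unit square, and over each
  corner the cone inequalities leave two consecutive values of \<open>z\<close>. This identifies the
  generators of the monoid.\<close>

lemma polytope_P_lattice_points: "polytope_P m \<inter> integer_lattice = polytope_vertices m"
proof
  show "polytope_vertices m \<subseteq> polytope_P m \<inter> integer_lattice"
    unfolding polytope_P_eq integer_lattice_3
    using hull_subset[of "polytope_vertices m" convex] by (auto simp: polytope_vertices_def)
  show "polytope_P m \<inter> integer_lattice \<subseteq> polytope_vertices m"
  proof
    fix v assume v: "v \<in> polytope_P m \<inter> integer_lattice"
    then obtain x y z where v_eq: "v = lattice_point x y z"
      by (auto simp: integer_lattice_3)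
    from v have "(v, 1) \<in> polytope_cone (real m)"
      by (auto intro: polytope_P_subset_cone)
    then have "0 \<le> x" "x \<le> 1" "0 \<le> y" "y \<le> 1" "0 \<le> z"
      and r: "real m * (of_int x + of_int y - 1) \<le> of_int z"
        "of_int z \<le> real m * of_int x + 1" "of_int z \<le> real m * of_int y + 1"
      by (auto simp: polytope_cone_def v_eq)
    then consider "x = 0" "y = 0" | "x = 1" "y = 0" | "x = 0" "y = 1" | "x = 1" "y = 1"
      by linarith
    then show "v \<in> polytope_vertices m"
    proof cases
      case 4
      with r have "int m \<le> z \<and> z \<le> int m + 1" by simp
      then have "z = int m \<or> z = int m + 1" by linarith
      with 4 show ?thesis by (auto simp: v_eq polytope_vertices_def)
    qed (use r \<open>0 \<le> z\<close> in \<open>auto simp: v_eq polytope_vertices_def\<close>)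
  qed
qed

lemma lattice_polytope_P: "lattice_polytope (polytope_P m)"
proof -
  have "finite (polytope_vertices m)"
    by (simp add: polytope_vertices_def)
  moreover have "polytope_vertices m \<subseteq> integer_lattice"
    using polytope_P_lattice_points by blast
  ultimately show ?thesis
    unfolding lattice_polytope_def polytope_P_eq
    using extreme_points_of_convex_hull polytope_convex_hull by blast
qed

section \<open>The monoid and its gaps\<close>

text \<open>The witness \<open>a\<close> counts the summands that lie over the corner \<open>(1, 1)\<close> of the unit square.\<close>

definition monoid_witness :: "nat \<Rightarrow> int \<Rightarrow> int \<Rightarrow> int \<Rightarrow> int \<Rightarrow> int \<Rightarrow> bool" where
  "monoid_witness m x y z k a \<longleftrightarrow>
     0 \<le> a \<and> x + y - k \<le> a \<and> a \<le> x \<and> a \<le> y \<and> int m * a \<le> z \<and> z \<le> int m * a + k"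

lemma polytope_monoid_P:
  "polytope_monoid (polytope_P m) = monoid_closure ((\<lambda>v. (v, 1)) ` polytope_vertices m)"
  by (simp add: polytope_monoid_def polytope_P_lattice_points)

text \<open>The strip inequalities are additive in all five variables, and a generator satisfies
  them with \<open>a = 1\<close> over the corner (1, 1) and \<open>a = 0\<close> over the other
  corners.\<close>

lemma polytope_monoid_witness:
  assumes "g \<in> polytope_monoid (polytope_P m)"
  shows "\<exists>x y z k a. g = graded_point x y z k \<and> monoid_witness m x y z k a"
  using assms unfolding polytope_monoid_P
proof induction
  case zero
  show ?case
    by (intro exI[of _ 0]) (simp add: graded_point_0 monoid_witness_def)
next
  case (base g)
  then obtain x y z where g: "g = graded_point x y z 1" and
    "lattice_point x y z \<in> polytope_vertices m"
    by (auto simp: polytope_vertices_def graded_point_def)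
  then have "monoid_witness m x y z 1 (if x = 1 \<and> y = 1 then 1 else 0)"
    by (auto simp: polytope_vertices_def monoid_witness_def)
  with g show ?case by blast
next
  case (add g h)
  then obtain x y z k a x' y' z' k' a' where
    "g = graded_point x y z k" "monoid_witness m x y z k a"
    "h = graded_point x' y' z' k'" "monoid_witness m x' y' z' k' a'"
    by blast
  then have "g + h = graded_point (x + x') (y + y') (z + z') (k + k')"
    "monoid_witness m (x + x') (y + y') (z + z') (k + k') (a + a')"
    by (auto simp: graded_point_add monoid_witness_def algebra_simps)
  then show ?case by blast
qed

text \<open>Induction on the height, removing one generator at a time: one over (1, 1) while
  \<open>a\<close> is positive, otherwise one over (1, 0) or (0, 1) if \<open>x\<close> or
  \<open>y\<close> is positive, and one over (0, 0) once both vanish.\<close>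

lemma monoid_witness_imp_mem_nat:
  assumes "monoid_witness m x y z (int k) a"
  shows "graded_point x y z (int k) \<in> polytope_monoid (polytope_P m)"
  using assms
proof (induction k arbitrary: x y z a)
  case 0
  then have "a = 0" "x = 0" "y = 0" "z = 0"
    by (auto simp: monoid_witness_def)
  then show ?case
    by (simp add: graded_point_0 polytope_monoid_P monoid_closure.zero)
next
  case (Suc k)
  \<comment> \<open>Of the two generators over a corner, the upper one is removed unless
    \<open>z\<close> is at the bottom of its strip; the offset of \<open>z\<close> in the strip, at
    most \<open>Suc k\<close> before, is then at most \<open>k\<close> after.\<close>
  define e :: int where "e = (if z = int m * a then 0 else 1)"
  have step: ?case
    if v: "lattice_point x' y' (int m * a' + e) \<in> polytope_vertices m"
      and w: "monoid_witness m (x - x') (y - y') (z - (int m * a' + e)) (int k) (a - a')" for x' y' a'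
  proof -
    have "graded_point x' y' (int m * a' + e) 1 \<in> polytope_monoid (polytope_P m)"
      unfolding polytope_monoid_P graded_point_def using v by (intro monoid_closure.base) auto
    from monoid_closure.add[OF this[unfolded polytope_monoid_P] Suc.IH[OF w, unfolded polytope_monoid_P]]
    show ?thesis
      by (simp add: graded_point_add polytope_monoid_P add.commute)
  qed
  consider "a \<ge> 1" | "a = 0" "x \<ge> 1" | "a = 0" "x = 0" "y \<ge> 1" | "a = 0" "x = 0" "y = 0"
    using Suc.prems by (auto simp: monoid_witness_def) linarith
  then show ?case
  proof cases
    case 1
    then show ?thesis
      using Suc.prems
      by (intro step[of 1 1 1]) (auto simp: polytope_vertices_def monoid_witness_def e_def algebra_simps)
  next
    case 2
    then show ?thesis
      using Suc.prems
      by (intro step[of 1 0 0]) (auto simp: polytope_vertices_def monoid_witness_def e_def)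
  next
    case 3
    then show ?thesis
      using Suc.prems
      by (intro step[of 0 1 0]) (auto simp: polytope_vertices_def monoid_witness_def e_def)
  next
    case 4
    then show ?thesis
      using Suc.prems
      by (intro step[of 0 0 0]) (auto simp: polytope_vertices_def monoid_witness_def e_def)
  qed
qed

lemma mem_polytope_monoid_iff:
  "graded_point x y z k \<in> polytope_monoid (polytope_P m) \<longleftrightarrow> (\<exists>a. monoid_witness m x y z k a)"
proof
  assume "graded_point x y z k \<in> polytope_monoid (polytope_P m)"
  then show "\<exists>a. monoid_witness m x y z k a"
    using polytope_monoid_witness by fastforce
next
  assume "\<exists>a. monoid_witness m x y z k a"
  then obtain a where a: "monoid_witness m x y z k a" by blast
  then have "0 \<le> k" by (auto simp: monoid_witness_def)
  then obtain n where "k = int n" using nonneg_int_cases by blast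
  with a show "graded_point x y z k \<in> polytope_monoid (polytope_P m)"
    using monoid_witness_imp_mem_nat by blast
qed

lemma polytope_monoid_subset_cone:
  "polytope_monoid (polytope_P m) \<subseteq> polytope_cone (real m)"
proof
  fix g assume "g \<in> polytope_monoid (polytope_P m)"
  then show "g \<in> polytope_cone (real m)"
    unfolding polytope_monoid_P
  proof induction
    case zero
    then show ?case
      by (rule convex_cone_contains_0[OF convex_cone_polytope_cone])
  next
    case (base g)
    then show ?case
      using polytope_P_lattice_points polytope_P_subset_cone by blast
  next
    case (add g h)
    then show ?case
      by (intro convex_cone_add convex_cone_polytope_cone)
  qed
qed

text \<open>Subtracting the generator (0, 0, 0, 1) from (1, 0, 0, 1), (0, 1, 0, 1) and (0, 0, 1, 1)
  gives the other unit vectors. So the group is the full integer lattice, and the normalization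
  consists of the lattice points of the cone.\<close>

lemma group_closure_polytope_monoid:
  "group_closure (polytope_monoid (polytope_P m)) = {graded_point x y z k | x y z k. True}"
    (is "group_closure ?M = ?G")
proof (intro equalityI subsetI)
  fix g assume "g \<in> group_closure ?M"
  then show "g \<in> ?G"
  proof induction
    case (base g)
    then show ?case
      using polytope_monoid_witness graded_point_0
      by (metis (mono_tags, lifting) insertE mem_Collect_eq)
  qed (auto simp: graded_point_diff)
next
  fix g assume "g \<in> ?G"
  then obtain x y z k where g: "g = graded_point x y z k" by blast
  have gen: "graded_point a b c 1 \<in> group_closure ?M"
    if "lattice_point a b c \<in> polytope_vertices m" for a b c
    using that unfolding polytope_monoid_P graded_point_def
    by (intro group_closure.base insertI2 monoid_closure.base) auto
  have "graded_point 0 0 0 1 \<in> group_closure ?M"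
    by (rule gen) (simp add: polytope_vertices_def)
  note diff = group_closure.diff[OF _ this]
  have "graded_point 1 0 0 0 \<in> group_closure ?M" "graded_point 0 1 0 0 \<in> group_closure ?M"
    "graded_point 0 0 1 0 \<in> group_closure ?M"
    using diff[OF gen[of 1 0 0]] diff[OF gen[of 0 1 0]] diff[OF gen[of 0 0 1]]
    by (simp_all add: graded_point_diff polytope_vertices_def)
  note units = this \<open>graded_point 0 0 0 1 \<in> group_closure ?M\<close>
  have "of_int x *\<^sub>R graded_point 1 0 0 0 + of_int y *\<^sub>R graded_point 0 1 0 0 +
      of_int z *\<^sub>R graded_point 0 0 1 0 + of_int k *\<^sub>R graded_point 0 0 0 1 \<in> group_closure ?M"
    by (intro group_closure_add group_closure_of_int_scaleR units)
  moreover have "of_int x *\<^sub>R graded_point 1 0 0 0 + of_int y *\<^sub>R graded_point 0 1 0 0 +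
      of_int z *\<^sub>R graded_point 0 0 1 0 + of_int k *\<^sub>R graded_point 0 0 0 1 = g"
    by (simp add: g graded_point_def vec_eq_iff forall_3)
  ultimately show "g \<in> group_closure ?M" by simp
qed

text \<open>
  A point between two strips belongs to the normalization because it lies on the segment from
  the top of the lower strip to the bottom of the upper one.
\<close>

lemma mem_gaps_iff:
  "g \<in> gaps (polytope_P m) \<longleftrightarrow>
     (\<exists>x y k a t. g = graded_point x y (int m * a + k + t) k \<and>
        0 \<le> a \<and> x + y - k \<le> a \<and> a < x \<and> a < y \<and> 1 \<le> t \<and> k + t < int m)"
  (is "_ \<longleftrightarrow> ?R")
proof
  let ?M = "polytope_monoid (polytope_P m)"
  assume "g \<in> gaps (polytope_P m)"
  then obtain x y z k where g: "g = graded_point x y z k" and cone: "g \<in> convex_cone hull ?M"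
    and nM: "g \<notin> ?M"
    unfolding gaps_def normalization_def group_closure_polytope_monoid by blast
  have "g \<in> polytope_cone (real m)"
    using cone hull_minimal[OF polytope_monoid_subset_cone, of convex_cone] convex_cone_polytope_cone
    by blast
  then have
    "0 \<le> x" "x \<le> k" "0 \<le> y" "y \<le> k" "0 \<le> z"
    "of_int (int m * (x + y - k)) \<le> (of_int z :: real)"
    "of_int z \<le> (of_int (int m * x + k) :: real)" "of_int z \<le> (of_int (int m * y + k) :: real)"
    by (auto simp: g polytope_cone_def graded_point_def)
  then have b: "0 \<le> x" "x \<le> k" "0 \<le> y" "y \<le> k" "0 \<le> z" "int m * (x + y - k) \<le> z"
    "z \<le> int m * x + k" "z \<le> int m * y + k"
    unfolding of_int_le_iff by auto
  have nw: "\<not> monoid_witness m x y z k a" for a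
    using nM by (auto simp: g mem_polytope_monoid_iff)
  \<comment> \<open>For \<open>m = 0\<close> all strips coincide with [0, k], and the cone bounds
    put \<open>z\<close> there.\<close>
  have m: "m > 0"
  proof (rule ccontr)
    assume "\<not> m > 0"
    then have "monoid_witness m x y z k (min x y)"
      using b by (auto simp: monoid_witness_def)
    with nw show False by blast
  qed
  \<comment> \<open>The last strip that starts at or below \<open>z\<close> has index
    \<open>a\<close>, and \<open>r\<close> is the offset of \<open>z\<close> from its
    bottom.\<close>
  define a where "a = z div int m"
  define r where "r = z mod int m"
  have z: "z = int m * a + r" and r: "0 \<le> r" "r < int m"
    using m by (simp_all add: a_def r_def)
  have "0 \<le> a"
    using b(5) m by (simp add: a_def pos_imp_zdiv_nonneg_iff)
  have "x + y - k \<le> a"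
    using zdiv_mono1[OF b(6), of "int m"] m by (simp add: a_def)
  \<comment> \<open>Otherwise \<open>z\<close> is at or above the bottom of the topmost strip, of
    index \<open>min x y\<close>, and the upper cone bounds keep it inside that strip.\<close>
  have "a < x \<and> a < y"
  proof (rule ccontr)
    assume "\<not> (a < x \<and> a < y)"
    then have "min x y \<le> a" by auto
    then have "int m * min x y \<le> int m * a"
      by (intro mult_left_mono) auto
    then have "int m * min x y \<le> z" using z r by linarith
    moreover have "z \<le> int m * min x y + k" using b by (auto simp: min_def)
    ultimately have "monoid_witness m x y z k (min x y)"
      using b by (auto simp: monoid_witness_def)
    with nw show False by blast
  qed
  \<comment> \<open>Now \<open>a\<close> is an admissible index, so \<open>z\<close> can avoid its
    strip only by lying above the top.\<close>
  moreover have "k < r"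
    using nw[of a] \<open>0 \<le> a\<close> \<open>x + y - k \<le> a\<close> calculation z r by (auto simp: monoid_witness_def)
  ultimately show ?R
    using \<open>0 \<le> a\<close> \<open>x + y - k \<le> a\<close> r
    by (intro exI[of _ x] exI[of _ y] exI[of _ k] exI[of _ a] exI[of _ "r - k"]) (auto simp: g z)
next
  let ?M = "polytope_monoid (polytope_P m)"
  assume ?R
  then obtain x y k a t where g: "g = graded_point x y (int m * a + k + t) k"
    and a: "0 \<le> a" "x + y - k \<le> a" "a < x" "a < y" and t: "1 \<le> t" "k + t < int m"
    by blast
  define lo hi where "lo = graded_point x y (int m * a + k) k"
    and "hi = graded_point x y (int m * (a + 1)) k"
  have "k \<ge> 0" using a by linarith
  have "lo \<in> ?M"
    unfolding lo_def mem_polytope_monoid_iff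
    using a \<open>k \<ge> 0\<close> by (intro exI[of _ a]) (auto simp: monoid_witness_def)
  moreover have "hi \<in> ?M"
    unfolding hi_def mem_polytope_monoid_iff
    using a \<open>k \<ge> 0\<close> by (intro exI[of _ "a + 1"]) (auto simp: monoid_witness_def)
  \<comment> \<open>The space between the two strips has length \<open>m - k\<close>, and
    \<open>t\<close> is the distance of the point from its lower end.\<close>
  moreover define u :: real where "u = of_int t / of_int (int m - k)"
  have u: "0 \<le> u" "u \<le> 1" "u * (of_int (int m) - of_int k) = of_int t"
    using t by (auto simp: u_def field_simps)
  ultimately have "(1 - u) *\<^sub>R lo + u *\<^sub>R hi \<in> convex_cone hull ?M"
    by (intro convex_cone_hull_add convex_cone_hull_mul hull_inc) auto
  moreover have "(1 - u) *\<^sub>R lo + u *\<^sub>R hi = g"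
    using u(3) by (auto simp: lo_def hi_def g graded_point_def vec_eq_iff forall_3 algebra_simps)
  ultimately have "g \<in> convex_cone hull ?M" by simp
  moreover have "\<not> monoid_witness m x y (int m * a + k + t) k a'" for a'
  proof
    assume w: "monoid_witness m x y (int m * a + k + t) k a'"
    show False
    \<comment> \<open>Strips of index at most \<open>a\<close> end below the point; those of index
      at least \<open>a + 1\<close> start above it.\<close>
    proof (cases "a' \<le> a")
      case True
      then have "int m * a' \<le> int m * a" by (intro mult_left_mono) auto
      with w t show ?thesis by (auto simp: monoid_witness_def)
    next
      case False
      then have "int m * (a + 1) \<le> int m * a'" by (intro mult_left_mono) auto
      with w t show ?thesis by (auto simp: monoid_witness_def algebra_simps)
    qed
  qed
  ultimately show "g \<in> gaps (polytope_P m)"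
    unfolding gaps_def normalization_def group_closure_polytope_monoid
    by (auto simp: g mem_polytope_monoid_iff)
qed

section \<open>Counting gaps\<close>

text \<open>
  The list \<open>[p, q, r, s]\<close> records the slacks of the four inequalities
  \<open>x + y - k \<le> s\<close>, \<open>s < x\<close>, \<open>s < y\<close>, \<open>0 \<le> s\<close>, which add up to \<open>k - 2\<close>.
\<close>

lemma gaps_height_eq:
  "{g \<in> gaps (polytope_P m). snd g = real k} =
     (\<lambda>(l, t). graded_point (int (l ! 1 + l ! 3 + 1)) (int (l ! 2 + l ! 3 + 1))
        (int m * int (l ! 3) + int k + int t) (int k)) `
       ({l. length l = 4 \<and> sum_list l + 2 = k} \<times> {1..<m - k})" (is "?A = ?f ` ?B")
proof (intro equalityI subsetI)
  fix g assume "g \<in> ?A"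
  then obtain x y k' a t where g: "g = graded_point x y (int m * a + k' + t) k'"
    and a: "0 \<le> a" "x + y - k' \<le> a" "a < x" "a < y" and t: "1 \<le> t" "k' + t < int m"
    unfolding mem_gaps_iff mem_Collect_eq by blast
  have "real_of_int k' = real_of_int (int k)"
    using \<open>g \<in> ?A\<close> by (simp add: g)
  then have k': "k' = int k"
    by (simp only: of_int_eq_iff)
  note g = g[unfolded k'] and a = a[unfolded k'] and t = t[unfolded k']
  define l where "l = [nat (int k - x - y + a), nat (x - a - 1), nat (y - a - 1), nat a]"
  have "(l, nat t) \<in> ?B"
    using a t by (auto simp: l_def)
  moreover have "g = ?f (l, nat t)"
    using a t by (simp add: g l_def eval_nat_numeral)
  ultimately show "g \<in> ?f ` ?B" by blast
next
  fix g assume "g \<in> ?f ` ?B"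
  then obtain l t where l: "length l = 4" "sum_list l + 2 = k" and t: "1 \<le> t" "t < m - k"
    and g: "g = ?f (l, t)"
    by auto
  from l obtain p q r s where pqrs: "l = [p, q, r, s]"
    by (auto simp: length_Suc_conv eval_nat_numeral)
  have "g = graded_point (int (q + s + 1)) (int (r + s + 1)) (int m * int s + int k + int t) (int k)"
    by (simp add: g pqrs eval_nat_numeral)
  moreover have "int (q + s + 1) + int (r + s + 1) - int k \<le> int s" "int k + int t < int m"
    using l t by (simp_all add: pqrs)
  ultimately have "g \<in> gaps (polytope_P m)"
    unfolding mem_gaps_iff using t
    by (intro exI[of _ "int (q + s + 1)"] exI[of _ "int (r + s + 1)"] exI[of _ "int k"]
        exI[of _ "int s"] exI[of _ "int t"]) simp
  then show "g \<in> ?A"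
    by (simp add: g)
qed

lemma finite_lists_sum_list_eq: "finite {l :: nat list. length l = n \<and> sum_list l + c = k}"
proof (rule finite_subset)
  show "{l. length l = n \<and> sum_list l + c = k} \<subseteq> {l. set l \<subseteq> {..k} \<and> length l = n}"
    using member_le_sum_list by fastforce
qed (simp add: finite_lists_length_eq)

lemma finite_gaps_height: "finite {g \<in> gaps (polytope_P m). snd g = real k}"
  unfolding gaps_height_eq by (intro finite_imageI finite_cartesian_product finite_lists_sum_list_eq) auto

text \<open>The parametrization by compositions and \<open>t\<close> is injective, so the count is a
  product. Truncated subtraction gives the correct value 0 for large \<open>k\<close>.\<close>

lemma gap_vector_entry_P: "gap_vector_entry (polytope_P m) k = ((k + 1) choose 3) * (m - k - 1)"
proof -
  let ?L = "{l :: nat list. length l = 4 \<and> sum_list l + 2 = k}"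
  let ?f = "\<lambda>(l, t). graded_point (int (l ! 1 + l ! 3 + 1)) (int (l ! 2 + l ! 3 + 1))
        (int m * int (l ! 3) + int k + int t) (int k)"
  have "inj_on ?f (?L \<times> {1..<m - k})"
  proof (rule inj_onI, clarify)
    fix l t l' t'
    assume l: "length l = 4" "length l' = 4" "k = sum_list l + 2" "sum_list l' + 2 = sum_list l + 2"
      and t: "t \<in> {1..<m - (sum_list l + 2)}" "t' \<in> {1..<m - (sum_list l + 2)}"
      and eq: "graded_point (int (l ! 1 + l ! 3 + 1)) (int (l ! 2 + l ! 3 + 1))
        (int m * int (l ! 3) + int (sum_list l + 2) + int t) (int (sum_list l + 2)) =
       graded_point (int (l' ! 1 + l' ! 3 + 1)) (int (l' ! 2 + l' ! 3 + 1))
        (int m * int (l' ! 3) + int (sum_list l + 2) + int t') (int (sum_list l + 2))"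
    obtain p q r s where l1: "l = [p, q, r, s]"
      using l(1) by (auto simp: length_Suc_conv eval_nat_numeral)
    obtain p' q' r' s' where l2: "l' = [p', q', r', s']"
      using l(2) by (auto simp: length_Suc_conv eval_nat_numeral)
    have "int m * int s + int t = int m * int s' + int t'"
      using eq by (simp add: l1 l2 eval_nat_numeral)
    then have e: "m * s + t = m * s' + t'"
      by (metis of_nat_add of_nat_eq_iff of_nat_mult)
    have tm: "t < m" "t' < m" using t by auto
    \<comment> \<open>Since \<open>t < m\<close>, the third coordinate determines \<open>s\<close>
      and \<open>t\<close> by division with remainder.\<close>
    have "(m * s + t) div m = s" "(m * s' + t') div m = s'"
      using tm by auto
    with e have "s = s'" by simp
    with e have "t = t'" by simp
    \<comment> \<open>The slack \<open>p\<close> does not occur in the point; the prescribed sum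
      determines it.\<close>
    with \<open>s = s'\<close> eq l show "l = l' \<and> t = t'"
      by (auto simp: l1 l2 eval_nat_numeral)
  qed
  then have "gap_vector_entry (polytope_P m) k = card ?L * (m - k - 1)"
    unfolding gap_vector_entry_def gaps_height_eq by (simp add: card_image card_cartesian_product)
  moreover have "card ?L = (k + 1) choose 3"
  \<comment> \<open>Stars and bars needs the genuine difference \<open>k - 2\<close>; for smaller
    \<open>k\<close> both sides are 0.\<close>
  proof (cases "k \<ge> 2")
    case True
    then have "?L = {l. length l = 4 \<and> sum_list l = k - 2}" by auto
    then have "card ?L = (k + 1) choose (k - 2)"
      using True card_length_sum_list[of 4 "k - 2"] by simp
    also have "\<dots> = (k + 1) choose 3"
      using True binomial_symmetric[of 3 "k + 1"] by (simp add: eval_nat_numeral)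
    finally show ?thesis .
  next
    case False
    then have "?L = {}" by auto
    with False show ?thesis by simp
  qed
  ultimately show ?thesis by simp
qed

text \<open>From \<open>a < x\<close> and \<open>a < y\<close> follows k \<ge> x + y - a \<ge> a +
  2, and t \<ge> 1 leaves k \<le> m - 2.\<close>

lemma gap_height_cases:
  assumes "g \<in> gaps (polytope_P m)"
  obtains k where "snd g = real k" "2 \<le> k" "k + 2 \<le> m"
proof -
  obtain x y k a t where g: "g = graded_point x y (int m * a + k + t) k"
    "0 \<le> a" "x + y - k \<le> a" "a < x" "a < y" "1 \<le> t" "k + t < int m"
    using assms unfolding mem_gaps_iff by blast
  then show ?thesis
    by (intro that[of "nat k"]) auto
qed

lemma finite_gaps: "finite (gaps (polytope_P m))"
proof (rule finite_subset)
  show "gaps (polytope_P m) \<subseteq> (\<Union>k\<in>{..m}. {g \<in> gaps (polytope_P m). snd g = real k})"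
  proof
    fix g assume g: "g \<in> gaps (polytope_P m)"
    then obtain k where "snd g = real k" "2 \<le> k" "k + 2 \<le> m"
      by (rule gap_height_cases)
    with g show "g \<in> (\<Union>k\<in>{..m}. {g \<in> gaps (polytope_P m). snd g = real k})"
      by auto
  qed
qed (auto simp: finite_gaps_height)

text \<open>Read off from the product formula: the binomial vanishes exactly below
  \<open>k = 2\<close>, the other factor exactly above \<open>m - 2\<close>.\<close>

lemma gap_height_iff:
  "(\<exists>g \<in> gaps (polytope_P m). snd g = real k) \<longleftrightarrow> 2 \<le> k \<and> k + 2 \<le> m"
proof -
  have "(\<exists>g \<in> gaps (polytope_P m). snd g = real k) \<longleftrightarrow> gap_vector_entry (polytope_P m) k \<noteq> 0"
    unfolding gap_vector_entry_def using finite_gaps_height[of m k] by (subst card_eq_0_iff) blast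
  also have "\<dots> \<longleftrightarrow> 2 \<le> k \<and> k + 2 \<le> m"
    by (auto simp: gap_vector_entry_P)
  finally show ?thesis .
qed

text \<open>The gap heights fill the interval from 2 to \<open>m - 2\<close>. It is empty for
  \<open>m < 4\<close>, where the default value 0 applies.\<close>

lemma max_gap_height_P: "max_gap_height (polytope_P m) = (if m \<ge> 4 then m - 2 else 0)"
proof (cases "m \<ge> 4")
  case True
  then have "gaps (polytope_P m) \<noteq> {}"
    using gap_height_iff[of m 2] by auto
  moreover have "Max {k. \<exists>g \<in> gaps (polytope_P m). snd g = real k} = m - 2"
    unfolding gap_height_iff by (rule Max_eqI) (use True in \<open>auto intro: finite_subset[of _ "{..m}"]\<close>)
  ultimately show ?thesis
    using True by (simp add: max_gap_height_def)
next
  case False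
  then have "gaps (polytope_P m) = {}"
    by (auto elim!: gap_height_cases)
  with False show ?thesis
    by (simp add: max_gap_height_def)
qed

section \<open>Very ampleness\<close>

text \<open>The origin and the three unit vectors are vertices, so their differences already
  generate the lattice.\<close>

lemma difference_group_P:
  "group_closure {x - y | x y. x \<in> polytope_P m \<inter> integer_lattice \<and>
     y \<in> polytope_P m \<inter> integer_lattice} = integer_lattice" (is "group_closure ?D = _")
proof (intro equalityI subsetI)
  fix v assume "v \<in> group_closure ?D"
  then show "v \<in> integer_lattice"
    by induction (auto simp: integer_lattice_def)
next
  fix v :: "real ^ 3"
  assume "v \<in> integer_lattice"
  then obtain x y z where v: "v = lattice_point x y z"
    by (auto simp: integer_lattice_3)
  have gen: "lattice_point a b c \<in> group_closure ?D"
    if "lattice_point a b c \<in> polytope_vertices m" for a b c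
  proof (rule group_closure.base, rule insertI2)
    have "lattice_point a b c = lattice_point a b c - lattice_point 0 0 0"
      by (simp add: lattice_point_diff)
    moreover have "lattice_point 0 0 0 \<in> polytope_vertices m"
      by (simp add: polytope_vertices_def)
    ultimately show "lattice_point a b c \<in> ?D"
      unfolding polytope_P_lattice_points using that by blast
  qed
  have "of_int x *\<^sub>R lattice_point 1 0 0 + of_int y *\<^sub>R lattice_point 0 1 0 +
      of_int z *\<^sub>R lattice_point 0 0 1 \<in> group_closure ?D"
    by (intro group_closure_add group_closure_of_int_scaleR gen) (auto simp: polytope_vertices_def)
  moreover have "of_int x *\<^sub>R lattice_point 1 0 0 + of_int y *\<^sub>R lattice_point 0 1 0 +
      of_int z *\<^sub>R lattice_point 0 0 1 = v"
    by (simp add: v vec_eq_iff forall_3)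
  ultimately show "v \<in> group_closure ?D" by simp
qed

text \<open>The complement is the zero subgroup.\<close>

lemma direct_summand_refl:
  assumes "group_closure G = G"
  shows "direct_summand G G"
proof -
  have "0 \<in> G" using assms zero_in_group_closure by blast
  then show ?thesis
    unfolding direct_summand_def using assms
    by (intro conjI exI[of _ "{0}"]) (use group_closure_insert_zero[of "{}"] in auto)
qed

lemma group_closure_integer_lattice: "group_closure integer_lattice = integer_lattice"
proof (intro equalityI subsetI)
  fix v :: "real ^ 'd"
  assume "v \<in> group_closure integer_lattice"
  then show "v \<in> integer_lattice"
    by induction (auto simp: integer_lattice_def)
qed (auto intro: group_closure.base)

lemma very_ample_P: "very_ample (polytope_P m)"
  unfolding very_ample_def difference_group_P
  by (intro conjI lattice_polytope_P finite_gaps direct_summand_refl group_closure_integer_lattice)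

section \<open>Unimodality of the gap vector\<close>

text \<open>Clearing the denominator turns comparisons of entries into polynomial identities over
  the integers.\<close>

lemma choose_3_times_6: "6 * int ((k + 1) choose 3) = (int k + 1) * int k * (int k - 1)"
proof (induction k)
  case (Suc k)
  have "2 * int ((k + 1) choose 2) = (int k + 1) * int k"
    by (induction k) (auto simp: numeral_2_eq_2 algebra_simps)
  moreover have "(Suc k + 1) choose 3 = ((k + 1) choose 2) + ((k + 1) choose 3)"
    by (simp add: eval_nat_numeral)
  ultimately show ?case
    using Suc.IH by (simp add: algebra_simps)
qed simp

text \<open>The increment factors so that for positive \<open>k\<close> its sign is that of the
  linear factor, which changes where \<open>4 * k + 5\<close> passes \<open>3 * m\<close>.\<close>

lemma gap_count_diff:
  "6 * (int ((k + 2) choose 3) * (m - int k - 2) - int ((k + 1) choose 3) * (m - int k - 1)) =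
     int k * (int k + 1) * (3 * m - 4 * int k - 5)"
proof -
  have "6 * int ((k + 2) choose 3) = (int k + 2) * (int k + 1) * int k"
    using choose_3_times_6[of "k + 1"] by (simp add: add.commute numeral_2_eq_2)
  then have "6 * int ((k + 2) choose 3) * (m - int k - 2) - 6 * int ((k + 1) choose 3) * (m - int k - 1)
     = (int k + 2) * (int k + 1) * int k * (m - int k - 2)
       - (int k + 1) * int k * (int k - 1) * (m - int k - 1)"
    by (simp only: choose_3_times_6)
  then show ?thesis
    by (simp add: algebra_simps)
qed

lemma gap_vector_entry_step:
  assumes "1 \<le> k" "k + 1 < m"
  shows "4 * k + 5 \<le> 3 * m \<Longrightarrow>
      gap_vector_entry (polytope_P m) k \<le> gap_vector_entry (polytope_P m) (k + 1)"
    and "3 * m \<le> 4 * k + 5 \<Longrightarrow>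
      gap_vector_entry (polytope_P m) k \<ge> gap_vector_entry (polytope_P m) (k + 1)"
proof -
  \<comment> \<open>The bound \<open>k + 1 < m\<close> makes both truncated subtractions agree with
    integer ones.\<close>
  have diff: "6 * (int (gap_vector_entry (polytope_P m) (k + 1))
      - int (gap_vector_entry (polytope_P m) k)) =
     int k * (int k + 1) * (3 * int m - 4 * int k - 5)"
    using assms gap_count_diff[of k "int m"]
    by (simp add: gap_vector_entry_P of_nat_diff diff_diff_add add.commute)
  show "gap_vector_entry (polytope_P m) k \<le> gap_vector_entry (polytope_P m) (k + 1)"
    if "4 * k + 5 \<le> 3 * m"
  proof -
    have "0 \<le> int k * (int k + 1) * (3 * int m - 4 * int k - 5)"
      using that by (intro mult_nonneg_nonneg) auto
    then show ?thesis
      unfolding diff[symmetric] by simp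
  qed
  show "gap_vector_entry (polytope_P m) k \<ge> gap_vector_entry (polytope_P m) (k + 1)"
    if "3 * m \<le> 4 * k + 5"
  proof -
    have "int k * (int k + 1) * (3 * int m - 4 * int k - 5) \<le> 0"
      using that by (intro mult_nonneg_nonpos) auto
    then show ?thesis
      unfolding diff[symmetric] by simp
  qed
qed

text \<open>The claim on the largest height is split because for \<open>m = 3\<close> the only
  entry, at \<open>k = 1\<close>, is 0: there are no gaps, and the convention gives 0 instead of
  \<open>m - 2 = 1\<close>.\<close>

theorem theorem3p3:
  fixes m :: nat
  assumes "m \<ge> 3"
  shows "very_ample (polytope_P m) \<and>
    (\<forall>k \<in> {1..m - 2}.
       int (gap_vector_entry (polytope_P m) k) =
         int ((k + 1) choose 3) * (int m - int k - 1)) \<and>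
    (m \<ge> 4 \<longrightarrow> max_gap_height (polytope_P m) = m - 2) \<and>
    (m = 3 \<longrightarrow> max_gap_height (polytope_P m) = 0) \<and>
    (let j = nat \<lceil>(3 * real m - 5) / 4\<rceil> in
       j \<in> {1..m - 2} \<and>
       (\<forall>k \<in> {1..<j}.
          gap_vector_entry (polytope_P m) k \<le> gap_vector_entry (polytope_P m) (k + 1)) \<and>
       (\<forall>k \<in> {j..<m - 2}.
          gap_vector_entry (polytope_P m) k \<ge> gap_vector_entry (polytope_P m) (k + 1)))"
proof -
  define j where "j = nat \<lceil>(3 * real m - 5) / 4\<rceil>"
  have "(3 * real m - 5) / 4 > 0" using assms by simp
  \<comment> \<open>Positivity ensures that \<open>nat\<close> does not truncate the
    ceiling.\<close>
  then have j: "real j = of_int \<lceil>(3 * real m - 5) / 4\<rceil>"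
    unfolding j_def by simp
  have bounds: "real j - 1 < (3 * real m - 5) / 4 \<and> (3 * real m - 5) / 4 \<le> real j"
    unfolding j by (rule ceiling_correct)
  \<comment> \<open>The first bound is the descent condition at \<open>k = j\<close>; the second
    gives the ascent condition up to \<open>k = j - 1\<close>, where \<open>4 * k + 5\<close> equals
    \<open>4 * j + 1\<close>.\<close>
  from bounds have "real (3 * m) \<le> real (4 * j + 5)" "real (4 * j + 1) < real (3 * m)"
    by (simp_all add: field_simps)
  then have j_lower: "3 * m \<le> 4 * j + 5" and j_upper: "4 * j + 1 < 3 * m"
    by (simp_all only: of_nat_le_iff of_nat_less_iff)
  have "j \<in> {1..m - 2}" using assms j_lower j_upper by auto
  moreover have "gap_vector_entry (polytope_P m) k \<le> gap_vector_entry (polytope_P m) (k + 1)"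
    if "k \<in> {1..<j}" for k
    using that j_upper assms by (intro gap_vector_entry_step(1)) auto
  moreover have "gap_vector_entry (polytope_P m) k \<ge> gap_vector_entry (polytope_P m) (k + 1)"
    if "k \<in> {j..<m - 2}" for k
    using that j_lower \<open>j \<in> {1..m - 2}\<close> by (intro gap_vector_entry_step(2)) auto
  moreover have "int (gap_vector_entry (polytope_P m) k) =
      int ((k + 1) choose 3) * (int m - int k - 1)" if "k \<in> {1..m - 2}" for k
    using that by (auto simp: gap_vector_entry_P of_nat_diff)
  ultimately show ?thesis
    using very_ample_P assms by (simp add: max_gap_height_P flip: j_def)
qed

end
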